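(* Let $\mathbf r(t)=\sum_{i=0}^{q+1}\mathbf r_iN^{2n+1}_{i,\rho}(t)$, $t\in[t_n,t_{p+1}]$, $q=(n+1)(p+n)$, be the Pythagorean-Hodograph (PH) B-spline curve over the knot partition $\rho$, with hodograph $\mathbf p(t)=\mathbf z^2(t)=\sum_{k=0}^q\mathbf p_kN^{2n}_{k,\nu}(t)$, constructed in the context, where for a clamped, respectively closed, PH B-spline curve $\mathbf r(t)$ we assume $p=m$, respectively $p=m+n$. (a) For $\mathbf r(t)$ to be clamped, i.e. satisfying $$\mathbf r(t_n)=\mathbf r_0,\quad \mathbf r(t_{m+1})=\mathbf r_{q+1},\quad \mathbf r'(t_n)=\tfrac{2n+1}{s'_{2n+2}-s'_1}(\mathbf r_1-\mathbf r_0),\quad \mathbf r'(t_{m+1})=\tfrac{2n+1}{s'_{q+2n+2}-s'_{q+1}}(\mathbf r_{q+1}-\mathbf r_q),$$ the following conditions have to be fulfilled: $$\sum_{k=0}^n\mathbf r_{(n-1)(n+1)+k+1}B^n_k(\alpha)=\mathbf r_0\quad\text{and}\quad \sum_{k=0}^{n-1}\mathbf p_{(n-1)(n+1)+k+1}B^{n-1}_k(\alpha)=\mathbf p_0\quad\text{with}\quad \alpha=\frac{t_n-t_{n-1}}{t_{n+1}-t_{n-1}},$$ $$\sum_{k=0}^n\mathbf r_{m(n+1)+k+1}B^n_k(\beta)=\mathbf r_{q+1}\quad\text{and}\quad \sum_{k=0}^{n-1}\mathbf p_{m(n+1)+k+1}B^{n-1}_k(\beta)=\mathbf p_q\quad\text{with}\quad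 \beta=\frac{t_{m+1}-t_m}{t_{m+2}-t_m},$$ where $B^n_k(t)=\binom nk t^k(1-t)^{n-k}$, $k=0,\dots,n$, denote the Bernstein polynomials of degree $n$. (b) For $\mathbf r(t)$ to be closed and of continuity class $C^n$ at the junction point $\mathbf r(t_n)=\mathbf r(t_{m+n+1})$, we require the fulfillment of the conditions $$\sum_{j=n(n+1)-k}^{(m+n+1)(n+1)-k-1}(s_{j+2n+1}-s_j)\,\mathbf p_j=\mathbf 0\quad\text{for }k=0,\dots,n,$$ and $$t_{m+1+k}-t_{m+k}=t_k-t_{k-1}\quad\text{for }k=n,n+1.$$
   Context: Normalized B-splines: for a nondecreasing knot sequence $\mu=\{t_i\}$, $N^0_{i,\mu}(t)=1$ if $t\in[t_i,t_{i+1})$ and $0$ otherwise, and $N^n_{i,\mu}(t)=\frac{t-t_i}{t_{i+n}-t_i}N^{n-1}_{i,\mu}(t)+\frac{t_{i+n+1}-t}{t_{i+n+1}-t_{i+1}}N^{n-1}_{i+1,\mu}(t)$ with $0/0=0$. Basis functions are indexed starting at $0$. $\langle t\rangle^k$ denotes the knot $t$ repeated $k$ times. Points of $\mathbb R^2$ are identified with complex numbers. Construction. Let $n,p\in\mathbb N$, $p\ge n$, let $\mu=\{t_i\}_{i=0,\dots,p+n+1}$, $t_i\le t_{i+1}$, be a knot partition, $\mathbf z_0,\dots,\mathbf z_p\in\mathbb C$, $\mathbf z(t)=\sum_{i=0}^p\mathbf z_iN^n_{i,\mu}(t)$, $t\in[t_n,t_{p+1}]$. Let $\nu=\{s_i\}_{i=0,\dots,(p+n+2)(n+1)-1}=\{\langle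 t_i\rangle^{n+1}\}_{i=0,\dots,p+n+1}$. For $0\le i,j\le p$, $\chi^{i,j}=(\chi^{i,j}_0,\dots,\chi^{i,j}_q)^T$ is the solution of $A\chi^{i,j}=b^{i,j}$ with $a_{k,l}=\int_{t_0}^{t_{p+n+1}}N^{2n}_{k,\nu}N^{2n}_{l,\nu}\,dt$, $b^{i,j}_l=\int_{t_0}^{t_{p+n+1}}N^n_{i,\mu}N^n_{j,\mu}N^{2n}_{l,\nu}\,dt$, giving $N^n_{i,\mu}N^n_{j,\mu}=\sum_{k=0}^q\chi^{i,j}_kN^{2n}_{k,\nu}$; and $\mathbf p_k=\sum_{i,j=0}^p\chi^{i,j}_k\mathbf z_i\mathbf z_j$, so that $\mathbf z^2=\sum_{k=0}^q\mathbf p_kN^{2n}_{k,\nu}$. Let $t_{-1}\le t_0$, $t_{p+n+2}\ge t_{p+n+1}$ and $\rho=\{s'_i\}_{i=0,\dots,(p+n+2)(n+1)+1}=\{t_{-1},\{\langle t_k\rangle^{n+1}\}_{k=0,\dots,p+n+1},t_{p+n+2}\}$, so $s'_i=s_{i-1}$ for $1\le i\le(p+n+2)(n+1)$. With $\mathbf r_0$ arbitrary, $\mathbf r_{i+1}=\mathbf r_i+\frac{s_{i+2n+1}-s_i}{2n+1}\mathbf p_i$ for $i=0,\dots,q$; then $\mathbf r=\int\mathbf p\,dt$ on $[t_n,t_{p+1}]$.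
   Formalization: In (b) the knot-spacing equalities are assumed, and closed and C^n is proved equivalent to the sum conditions; the equalities are not necessary (z = 0 gives a constant curve for any knots). "The solution" χ is taken as unique, which forces distinct knots. *)

theory Defs
  imports "HOL-Analysis.Analysis"
begin

(* Normalized B-spline of degree d and index i over the knots u.  The convention 0/0 = 0 is
   the one of HOL (x / 0 = 0): whenever a denominator vanishes, the B-spline of lower degree
   next to it is identically zero. *)
fun bspline :: "(nat \<Rightarrow> real) \<Rightarrow> nat \<Rightarrow> nat \<Rightarrow> real \<Rightarrow> real" where
  "bspline u 0 i x = (if u i \<le> x \<and> x < u (i + 1) then 1 else 0)"
| "bspline u (Suc d) i x =
     (x - u i) / (u (i + Suc d) - u i) * bspline u d i x
     + (u (i + Suc d + 1) - x) / (u (i + Suc d + 1) - u (i + 1)) * bspline u d (i + 1) x"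

(* The spline of degree d over u with the control points c 0, ..., c N. *)
definition spline_curve ::
    "(nat \<Rightarrow> real) \<Rightarrow> nat \<Rightarrow> nat \<Rightarrow> (nat \<Rightarrow> complex) \<Rightarrow> real \<Rightarrow> complex" where
  "spline_curve u d N c x = (\<Sum>i\<le>N. bspline u d i x *\<^sub>R c i)"

(* Every knot of t repeated n + 1 times. *)
definition nu_knots :: "nat \<Rightarrow> (nat \<Rightarrow> real) \<Rightarrow> nat \<Rightarrow> real" where
  "nu_knots n t i = t (i div (n + 1))"

(* The (p + n + 2) (n + 1) knots of nu, with one knot t_left added in front and one knot
   t_right added at the end. *)
definition rho_knots ::
    "nat \<Rightarrow> nat \<Rightarrow> (nat \<Rightarrow> real) \<Rightarrow> real \<Rightarrow> real \<Rightarrow> nat \<Rightarrow> real" where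
  "rho_knots n p t t_left t_right i =
     (if i = 0 then t_left
      else if i \<le> (p + n + 2) * (n + 1) then nu_knots n t (i - 1)
      else t_right)"

definition gram_entry :: "nat \<Rightarrow> nat \<Rightarrow> (nat \<Rightarrow> real) \<Rightarrow> nat \<Rightarrow> nat \<Rightarrow> real" where
  "gram_entry n p t k l =
     integral {t 0..t (p + n + 1)}
       (\<lambda>x. bspline (nu_knots n t) (2 * n) k x * bspline (nu_knots n t) (2 * n) l x)"

definition rhs_entry ::
    "nat \<Rightarrow> nat \<Rightarrow> (nat \<Rightarrow> real) \<Rightarrow> nat \<Rightarrow> nat \<Rightarrow> nat \<Rightarrow> real" where
  "rhs_entry n p t i j l =
     integral {t 0..t (p + n + 1)}
       (\<lambda>x. bspline t n i x * bspline t n j x * bspline (nu_knots n t) (2 * n) l x)"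

definition solves ::
    "nat \<Rightarrow> (nat \<Rightarrow> nat \<Rightarrow> real) \<Rightarrow> (nat \<Rightarrow> real) \<Rightarrow> (nat \<Rightarrow> real) \<Rightarrow> bool" where
  "solves q A b x \<longleftrightarrow> (\<forall>k\<le>q. (\<Sum>l\<le>q. A k l * x l) = b k)"

(* x is the solution of A x = b, for vectors and matrices with index range 0, ..., q: the
   definite article is taken to include that there is no other solution. *)
definition is_the_solution ::
    "nat \<Rightarrow> (nat \<Rightarrow> nat \<Rightarrow> real) \<Rightarrow> (nat \<Rightarrow> real) \<Rightarrow> (nat \<Rightarrow> real) \<Rightarrow> bool" where
  "is_the_solution q A b x \<longleftrightarrow>
     solves q A b x \<and> (\<forall>y. solves q A b y \<longrightarrow> (\<forall>k\<le>q. y k = x k))"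

(* The curve f on [a, b] is closed and of class C^n, also where its end meets its start: D l is
   the l-th derivative of f on [a, b], one-sided at a and at b, and the derivatives of the
   orders 0, ..., n at the two ends agree. *)
definition closed_Cn :: "nat \<Rightarrow> (real \<Rightarrow> complex) \<Rightarrow> real \<Rightarrow> real \<Rightarrow> bool" where
  "closed_Cn n f a b \<longleftrightarrow>
     (\<exists>D :: nat \<Rightarrow> real \<Rightarrow> complex.
        (\<forall>x\<in>{a..b}. D 0 x = f x) \<and>
        (\<forall>l<n. \<forall>x\<in>{a..b}. (D l has_vector_derivative D (Suc l) x) (at x within {a..b})) \<and>
        continuous_on {a..b} (D n) \<and>
        (\<forall>l\<le>n. D l a = D l b))"

end

theory Submission
  imports Defs
begin

text \<open>
  Unique solvability of the Gram systems forces the knots \<open>t\<^sub>0, \<dots>, t\<^sub>p\<^sub>+\<^sub>n\<^sub>+\<^sub>1\<close> to be strictly increasing, so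
  every interior knot of \<open>\<rho>\<close> has multiplicity exactly \<open>n + 1\<close>. A spline of degree \<open>n + 1 + e\<close> with
  \<open>e \<le> n\<close> is then continuous at such a knot, and its value there is the combination of \<open>e + 1\<close>
  consecutive control points with Bernstein weights of degree \<open>e\<close>. Applied to \<open>r\<close> and to its
  derivative this gives (a), because the first differences of the \<open>r\<^sub>i\<close> are the \<open>p\<^sub>i\<close> up to scaling.

  For (b), the \<open>l\<close>-th derivative at a knot (\<open>l \<le> n\<close>) is, up to a factor depending on the knot spacing only,
  the Bernstein combination of degree \<open>n - l\<close> of the \<open>l\<close>-th differences of \<open>n + 1\<close> control points.
  Let \<open>e\<^sub>k\<close> be the differences between the control points relevant at the two ends, where the spacings
  agree. If all these combinations vanish, then downward induction on \<open>l\<close> shows that the \<open>l\<close>-th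
  differences of \<open>e\<close> are constant, hence zero since Bernstein polynomials sum to one. By telescoping,
  \<open>e = 0\<close> is the stated condition on the \<open>p\<^sub>j\<close>.
\<close>

section \<open>Monotone knots, polynomial pieces of B-splines and their derivatives\<close>

lemma knots_mono:
  fixes t :: "nat \<Rightarrow> real"
  assumes "\<And>i. i < K \<Longrightarrow> t i \<le> t (i + 1)"
  shows "mono_on {..K} t"
proof (rule mono_onI)
  fix i j assume "i \<in> {..K}" "j \<in> {..K}" "i \<le> j"
  from this(3,2) show "t i \<le> t j"
  proof (induction j rule: dec_induct)
    case (step j)
    then show ?case using assms[of j] by simp
  qed simp
qed

text \<open>The polynomial which coincides with the B-spline on \<open>[u j, u (j + 1))\<close>.\<close>

fun bspline_piece :: "(nat \<Rightarrow> real) \<Rightarrow> nat \<Rightarrow> nat \<Rightarrow> nat \<Rightarrow> real \<Rightarrow> real" where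
  "bspline_piece u j 0 i x = (if i = j then 1 else 0)"
| "bspline_piece u j (Suc d) i x =
     (x - u i) / (u (i + Suc d) - u i) * bspline_piece u j d i x
     + (u (i + Suc d + 1) - x) / (u (i + Suc d + 1) - u (i + 1)) * bspline_piece u j d (i + 1) x"

lemma bspline_piece_eq_0: "j < i \<or> i + d < j \<Longrightarrow> bspline_piece u j d i x = 0"
  by (induction d arbitrary: i) auto

text \<open>Both sides obey the same recursion, so only degree 0 matters; there monotone knots keep
  \<open>x\<close> out of every interval but the \<open>j\<close>-th. The bound
  \<open>i + d < K\<close> keeps all knots involved, up to \<open>u (i + d + 1)\<close>, in the
  monotone range.\<close>

lemma bspline_eq_piece:
  assumes "mono_on {..K} u" "u j \<le> x" "x < u (Suc j)" "j < K"
  shows "i + d < K \<Longrightarrow> bspline u d i x = bspline_piece u j d i x"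
proof (induction d arbitrary: i)
  case 0
  have "u (Suc i) \<le> u j" if "i < j"
    using that assms by (intro mono_onD[OF assms(1)]) auto
  moreover have "u (Suc j) \<le> u i" if "j < i"
    using that assms 0 by (intro mono_onD[OF assms(1)]) auto
  ultimately show ?case
    using assms by (cases i j rule: linorder_cases) fastforce+
qed auto

lemma bspline_eq_0:
  assumes "mono_on {..K} u" "i + d < K" "u (i + Suc d) \<le> u i"
  shows "bspline u d i x = 0"
  using assms(2,3)
proof (induction d arbitrary: i)
  case 0
  then show ?case by auto
next
  case (Suc d)
  have "u i \<le> u (Suc i)" "u (i + Suc d) \<le> u (i + Suc (Suc d))"
    using Suc.prems by (auto intro!: mono_onD[OF assms(1)])
  with Suc show ?case by simp
qed

text \<open>The classical derivative formula, stated for pieces because these are polynomials and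
  hence differentiable at the knots too. Product rule and induction reduce it to the identity
  \<open>key\<close>.\<close>

lemma has_field_derivative_bspline_piece:
  assumes "mono_on {..K} u"
  shows "i + d < K \<Longrightarrow> ((bspline_piece u j d i) has_real_derivative
           real d * (bspline_piece u j (d - 1) i x / (u (i + d) - u i)
             - bspline_piece u j (d - 1) (i + 1) x / (u (i + d + 1) - u (i + 1)))) (at x)"
proof (induction d arbitrary: i)
  case 0
  then show ?case by simp
next
  case (Suc d)
  define A where "A = (\<lambda>i. 1 / (u (i + Suc d) - u i))"
  define B where "B = (\<lambda>i. 1 / (u (i + d) - u i))"
  define P where "P = (\<lambda>i. bspline_piece u j d i x)"
  define Q where "Q = (\<lambda>i. bspline_piece u j (d - 1) i x)"
  have P: "P i = (x - u i) * B i * Q i + (u (i + d + 1) - x) * B (i + 1) * Q (i + 1)" if "d \<noteq> 0" for i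
    using that by (cases d) (auto simp: P_def B_def Q_def)
  have fn: "bspline_piece u j (Suc d) i =
    (\<lambda>x. (x - u i) * A i * bspline_piece u j d i x
      + (u (i + Suc d + 1) - x) * A (i + 1) * bspline_piece u j d (i + 1) x)"
    by (auto simp: A_def)
  have u1: "u i \<le> u (i + 1)" "u (i + d) \<le> u (i + Suc d)" "u (i + d + 1) \<le> u (i + Suc d + 1)"
      "d \<noteq> 0 \<Longrightarrow> u (i + 1) \<le> u (i + d)"
    using Suc.prems by (auto intro!: mono_onD[OF assms(1)])
  \<comment> \<open>A zero denominator is harmless: if the inner span is zero, then
    \<open>B (i + 1) = 0\<close>; otherwise the larger spans in \<open>A i\<close> and
    \<open>A (i + 1)\<close> are positive and cancel.\<close>
  have "d \<noteq> 0 \<Longrightarrow> B (i + 1) * (A i * (u (i + d + 1) - u i)) = B (i + 1)"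
    using u1 by (auto simp: A_def B_def)
  moreover have "d \<noteq> 0 \<Longrightarrow> B (i + 1) * (A (i + 1) * (u (i + d + 2) - u (i + 1))) = B (i + 1)"
    using u1 by (auto simp: A_def B_def)
  ultimately have tel: "d \<noteq> 0 \<Longrightarrow> B (i + 1) * (A i * (u (i + d + 1) - u i))
      = B (i + 1) * (A (i + 1) * (u (i + d + 2) - u (i + 1)))" by metis
  \<comment> \<open>The coefficients of \<open>Q i\<close> and \<open>Q (i + 2)\<close> agree
    outright, those of \<open>Q (i + 1)\<close> by \<open>tel\<close>.\<close>
  have key: "d \<noteq> 0 \<Longrightarrow> (x - u i) * A i * (Q i * B i - Q (i + 1) * B (i + 1))
      + (u (i + d + 2) - x) * A (i + 1) * (Q (i + 1) * B (i + 1) - Q (i + 2) * B (i + 2))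
      = P i * A i - P (i + 1) * A (i + 1)"
    using tel unfolding P[of i] P[of "i+1"] by simp algebra
  have D: "((bspline_piece u j d k) has_real_derivative
      real d * (Q k * B k - Q (k + 1) * B (k + 1))) (at x)" if "k \<le> i + 1" for k
    using Suc.IH[of k] Suc.prems that by (simp add: Q_def B_def)
  have "((bspline_piece u j (Suc d) i) has_real_derivative
      (A i * P i + (x - u i) * A i * (real d * (Q i * B i - Q (i + 1) * B (i + 1)))
      + (- A (i + 1) * P (i + 1) + (u (i + d + 2) - x) * A (i + 1)
         * (real d * (Q (i + 1) * B (i + 1) - Q (i + 2) * B (i + 2)))))) (at x)"
    unfolding fn
    by (rule derivative_eq_intros D refl | simp add: P_def)+
  also have "(A i * P i + (x - u i) * A i * (real d * (Q i * B i - Q (i + 1) * B (i + 1)))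
      + (- A (i + 1) * P (i + 1) + (u (i + d + 2) - x) * A (i + 1)
         * (real d * (Q (i + 1) * B (i + 1) - Q (i + 2) * B (i + 2)))))
     = A i * P i - A (i + 1) * P (i + 1) + real d * ((x - u i) * A i * (Q i * B i - Q (i + 1) * B (i + 1))
      + (u (i + d + 2) - x) * A (i + 1) * (Q (i + 1) * B (i + 1) - Q (i + 2) * B (i + 2)))"
    by (simp add: algebra_simps)
  also have "\<dots> = real (Suc d) * (P i * A i - P (i + 1) * A (i + 1))"
  proof (cases "d = 0")
    case False
    show ?thesis unfolding key[OF False] by (simp add: algebra_simps)
  qed (simp add: algebra_simps)
  finally show ?case by (simp add: P_def A_def)
qed

section \<open>Values of B-splines at a multiple knot, in Bernstein form\<close>

lemma Bernstein_Suc: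
  "Bernstein (Suc e) (Suc k) x = x * Bernstein e k x + (1 - x) * Bernstein e (Suc k) x"
proof (cases "k < e")
  case True
  then have "e - k = Suc (e - Suc k)" by simp
  then show ?thesis by (simp add: Bernstein_def algebra_simps)
next
  case False
  then have "e = k \<or> e < k" by auto
  then show ?thesis by (auto simp: Bernstein_def binomial_eq_0)
qed

lemma Bernstein_Suc_0: "Bernstein (Suc e) 0 x = (1 - x) * Bernstein e 0 x"
  by (simp add: Bernstein_def)

text \<open>Local picture at an inner knot \<open>\<tau>\<close>: the B-splines of degree below
  \<open>2 * M\<close> that do not vanish at \<open>\<tau>\<close> have all their knots in these
  three blocks.\<close>

locale knot_block =
  fixes u :: "nat \<Rightarrow> real" and h M :: nat and a \<tau> b :: real
  assumes ab: "a < \<tau>" "\<tau> < b"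
    and ua: "\<And>i. h \<le> i \<Longrightarrow> i < h + M \<Longrightarrow> u i = a"
    and ut: "\<And>i. h + M \<le> i \<Longrightarrow> i < h + 2 * M \<Longrightarrow> u i = \<tau>"
    and ub: "\<And>i. h + 2 * M \<le> i \<Longrightarrow> i < h + 3 * M \<Longrightarrow> u i = b"
    and M: "M > 0"
begin

text \<open>In the recursion at \<open>\<tau>\<close> the rising weight of the surviving B-spline is
  0 and the falling one is 1, so the surviving index drops by one with each degree. In
  \<open>piece_left_low\<close> the roles are swapped and the index stays put.\<close>

lemma piece_right_low:
  "e \<le> M \<Longrightarrow> bspline_piece u (h + 2 * M - 1) e i \<tau> = (if i + e + 1 = h + 2 * M then 1 else 0)"
proof (induction e arbitrary: i)
  case 0
  then show ?case using M by auto
next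
  case (Suc e)
  have "i + e + 1 = h + 2 * M \<Longrightarrow> u i = \<tau>" using Suc.prems by (intro ut) auto
  moreover have "i + e + 2 = h + 2 * M \<Longrightarrow> u (Suc i) = \<tau>" using Suc.prems by (intro ut) auto
  moreover have "i + e + 2 = h + 2 * M \<Longrightarrow> u (Suc (Suc (i + e))) = b" using Suc.prems by (intro ub) auto
  ultimately show ?case using Suc ab by auto
qed

lemma piece_left_low:
  "e \<le> M \<Longrightarrow> bspline_piece u (h + M - 1) e i \<tau> = (if i + 1 = h + M then 1 else 0)"
proof (induction e arbitrary: i)
  case 0
  then show ?case using M by auto
next
  case (Suc e)
  have "i + 1 = h + M \<Longrightarrow> u i = a" using Suc.prems by (intro ua) auto
  moreover have "i + 1 = h + M \<Longrightarrow> u (Suc (i + e)) = \<tau>" using Suc.prems by (intro ut) auto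
  moreover have "i + 2 = h + M \<Longrightarrow> u (Suc (Suc (i + e))) = \<tau>" using Suc.prems by (intro ut) auto
  ultimately show ?case using Suc ab by auto
qed

text \<open>At degree \<open>M\<close> the surviving indices from the left and from the right meet
  at \<open>h + M - 1\<close>; from there on both sides follow the same recursion. This is
  continuity at a knot of multiplicity \<open>M\<close>.\<close>

lemma piece_left_eq_right:
  "bspline_piece u (h + M - 1) (M + e) i \<tau> = bspline_piece u (h + 2 * M - 1) (M + e) i \<tau>"
  by (induction e arbitrary: i) (auto simp: piece_left_low piece_right_low simp del: One_nat_def)

text \<open>Each contributing B-spline of lower degree has first knot \<open>a\<close> and last knot
  \<open>b\<close>, so the weights at \<open>\<tau>\<close> are \<open>x\<close> and
  \<open>1 - x\<close> and the recursion becomes the Bernstein one. The guard catches truncated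
  subtraction; beyond the other end the binomial coefficient is 0.\<close>

lemma piece_right_Bernstein:
  "e < M \<Longrightarrow> bspline_piece u (h + 2 * M - 1) (M + e) i \<tau> =
     (if i + e + 1 < h + M then 0 else Bernstein e (i + e + 1 - (h + M)) ((\<tau> - a) / (b - a)))"
proof (induction e arbitrary: i)
  case 0
  then show ?case by (auto simp: piece_right_low Bernstein_def binomial_eq_0 simp del: One_nat_def)
next
  case (Suc e)
  define x where "x = (\<tau> - a) / (b - a)"
  have x1: "1 - x = (b - \<tau>) / (b - a)" using ab by (simp add: x_def field_simps)
  define k where "k = i + e + 1 - (h + M)"
  have IH1: "bspline_piece u (h + 2 * M - 1) (M + e) i \<tau> =
      (if i + e + 1 < h + M then 0 else Bernstein e k x)"
    and IH2: "bspline_piece u (h + 2 * M - 1) (M + e) (i + 1) \<tau> =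
      (if i + e + 2 < h + M then 0 else Bernstein e (i + e + 2 - (h + M)) x)"
    using Suc.IH[of i] Suc.IH[of "i + 1"] Suc.prems by (auto simp: x_def k_def)
  have first: "(\<tau> - u i) / (u (i + Suc (M + e)) - u i) * bspline_piece u (h + 2 * M - 1) (M + e) i \<tau>
      = (if i + e + 1 < h + M then 0 else x * Bernstein e k x)"
  proof (cases "h + M \<le> i + e + 1 \<and> i < h + M")
    case True
    then have "u i = a" "u (i + Suc (M + e)) = b" using Suc.prems by (auto intro!: ua ub)
    then show ?thesis unfolding IH1 using True by (simp add: x_def)
  next
    case False
    then show ?thesis unfolding IH1 by (auto simp: k_def Bernstein_def binomial_eq_0)
  qed
  have second: "(u (i + Suc (M + e) + 1) - \<tau>) / (u (i + Suc (M + e) + 1) - u (i + 1))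
        * bspline_piece u (h + 2 * M - 1) (M + e) (i + 1) \<tau>
      = (if i + e + 2 < h + M then 0 else (1 - x) * Bernstein e (i + e + 2 - (h + M)) x)"
  proof (cases "h + M \<le> i + e + 2 \<and> i + 1 < h + M")
    case True
    then have "u (i + 1) = a" "u (i + Suc (M + e) + 1) = b" using Suc.prems by (auto intro!: ua ub)
    then show ?thesis unfolding IH2 using True by (simp add: x1)
  next
    case False
    then show ?thesis unfolding IH2 by (auto simp: Bernstein_def binomial_eq_0)
  qed
  have "bspline_piece u (h + 2 * M - 1) (M + Suc e) i \<tau> =
     (if i + e + 1 < h + M then 0 else x * Bernstein e k x) +
     (if i + e + 2 < h + M then 0 else (1 - x) * Bernstein e (i + e + 2 - (h + M)) x)"
    by (simp only: add_Suc_right[of M e] bspline_piece.simps first second)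
  also have "\<dots> = (if i + Suc e + 1 < h + M then 0 else Bernstein (Suc e) (i + Suc e + 1 - (h + M)) x)"
  proof (cases "h + M \<le> i + e + 1")
    case True
    then have "i + e + 2 - (h + M) = Suc k" by (simp add: k_def)
    with True show ?thesis by (simp add: Bernstein_Suc)
  next
    case False
    then show ?thesis by (auto simp: Bernstein_Suc_0)
  qed
  finally show ?case by (simp add: x_def)
qed

end

section \<open>Derivatives of a spline over \<open>(n + 1)\<close>-fold knots\<close>

lemma sum_by_parts_nat:
  fixes G :: "nat \<Rightarrow> real" and c :: "nat \<Rightarrow> 'a::real_vector"
  assumes "l \<le> N"
  shows "(\<Sum>i=l..N. (G i - G (Suc i)) *\<^sub>R c i)
       = (\<Sum>i=Suc l..N. G i *\<^sub>R (c i - c (i - 1))) + G l *\<^sub>R c l - G (Suc N) *\<^sub>R c N"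
  using assms by (induction N rule: dec_induct) (simp_all add: algebra_simps)

text \<open>If \<open>x\<close> lies outside one of the closed sets, the filter within that set is
  \<open>bot\<close> and the derivative there is vacuous; so the limits along both sets always
  combine.\<close>

lemma has_vector_derivative_within_Un:
  assumes "closed S" "closed T"
    and "\<And>x. x \<in> S \<Longrightarrow> (f has_vector_derivative g x) (at x within S)"
    and "\<And>x. x \<in> T \<Longrightarrow> (f has_vector_derivative g x) (at x within T)"
    and "x \<in> S \<union> T"
  shows "(f has_vector_derivative g x) (at x within S \<union> T)"
proof -
  have "(f has_vector_derivative g x) (at x within U)" if "closed U"
    "x \<in> U \<Longrightarrow> (f has_vector_derivative g x) (at x within U)" for U
  proof (cases "x \<in> U")
    case False
    then have "at x within U = bot"
      using \<open>closed U\<close> by (simp add: at_within_eq_bot_iff)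
    then show ?thesis
      by (simp add: has_vector_derivative_def has_derivative_def bounded_linear_scaleR_left)
  qed (use that in auto)
  from this[of S] this[of T] show ?thesis
    using assms(1-4)
    unfolding has_vector_derivative_def has_derivative_iff_norm
    unfolding at_within_union by (auto intro: filterlim_sup)
qed

text \<open>The control points of the \<open>l\<close>-th derivative of a spline of degree \<open>d\<close>; only the indices
  \<open>i \<ge> l\<close> are meaningful.\<close>

primrec diff_coeff :: "(nat \<Rightarrow> real) \<Rightarrow> nat \<Rightarrow> (nat \<Rightarrow> 'a::real_vector) \<Rightarrow> nat \<Rightarrow> nat \<Rightarrow> 'a" where
  "diff_coeff u d c 0 i = c i"
| "diff_coeff u d c (Suc l) i =
     (real (d - l) / (u (i + (d - l)) - u i)) *\<^sub>R (diff_coeff u d c l i - diff_coeff u d c l (i - 1))"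

text \<open>Models \<open>rho\<close> with \<open>L = p + n\<close>. The \<open>Suc i\<close> is the
  shift by the added front knot; the first and the last knot are constrained by monotonicity
  only.\<close>

locale refined_knots =
  fixes n L :: nat and t u :: "nat \<Rightarrow> real" and c :: "nat \<Rightarrow> 'a::real_normed_vector"
  assumes t_less: "\<And>a. a \<le> L \<Longrightarrow> t a < t (Suc a)"
    and mono_u: "mono_on {..(L + 2) * Suc n + 1} u"
    and u_eq: "\<And>i. i < (L + 2) * Suc n \<Longrightarrow> u (Suc i) = t (i div Suc n)"
begin

lemma t_mono: "a \<le> b \<Longrightarrow> b \<le> Suc L \<Longrightarrow> t a \<le> t b"
  by (rule mono_onD[OF knots_mono[of "Suc L" t]]) (auto intro!: less_imp_le[OF t_less])

definition spline_deriv :: "nat \<Rightarrow> real \<Rightarrow> 'a" where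
  "spline_deriv l x = (\<Sum>i=l..L * Suc n + 1. bspline u (2 * n + 1 - l) i x *\<^sub>R diff_coeff u (2 * n + 1) c l i)"

text \<open>\<open>Suc a * Suc n\<close> is the index of the last knot equal to \<open>t a\<close>,
  so this is the polynomial of the interval from \<open>t a\<close> to
  \<open>t (Suc a)\<close>.\<close>

definition spline_piece :: "nat \<Rightarrow> nat \<Rightarrow> real \<Rightarrow> 'a" where
  "spline_piece a l x = (\<Sum>i=l..L * Suc n + 1.
      bspline_piece u (Suc a * Suc n) (2 * n + 1 - l) i x *\<^sub>R diff_coeff u (2 * n + 1) c l i)"

lemma u_block: "a \<le> Suc L \<Longrightarrow> a * Suc n < i \<Longrightarrow> i \<le> Suc a * Suc n \<Longrightarrow> u i = t a"
proof -
  assume *: "a \<le> Suc L" "a * Suc n < i" "i \<le> Suc a * Suc n"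
  then obtain i' where i': "i = Suc i'" by (cases i) auto
  have "Suc a * Suc n \<le> (L + 2) * Suc n" using * by (intro mult_right_mono) auto
  with * i' have "i' < (L + 2) * Suc n" by linarith
  moreover have "i' div Suc n = a"
    using * i' by (intro div_nat_eqI) (auto simp: mult.commute)
  ultimately show ?thesis using u_eq i' by simp
qed

lemma knot_block:
  assumes "1 \<le> a" "a \<le> L"
  shows "knot_block u ((a - 1) * Suc n + 1) (Suc n) (t (a - 1)) (t a) (t (a + 1))"
proof
  obtain a' where a': "a = Suc a'" using assms by (cases a) auto
  show "t (a - 1) < t a" "t a < t (a + 1)"
    using t_less[of a'] t_less[of a] a' assms by auto
  show "u i = t (a - 1)" if "(a - 1) * Suc n + 1 \<le> i" "i < (a - 1) * Suc n + 1 + Suc n" for i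
    using that a' assms by (intro u_block) auto
  show "u i = t a" if "(a - 1) * Suc n + 1 + Suc n \<le> i" "i < (a - 1) * Suc n + 1 + 2 * Suc n" for i
    using that assms a' by (intro u_block) auto
  show "u i = t (a + 1)" if "(a - 1) * Suc n + 1 + 2 * Suc n \<le> i" "i < (a - 1) * Suc n + 1 + 3 * Suc n" for i
    using that assms a' by (intro u_block) auto
qed simp

lemma spline_deriv_eq_piece_less:
  assumes "a \<le> L" "t a \<le> x" "x < t (Suc a)"
  shows "spline_deriv l x = spline_piece a l x"
proof -
  have u: "u (Suc a * Suc n) = t a" "u (Suc (Suc a * Suc n)) = t (Suc a)"
    using assms by (intro u_block; simp)+
  have "Suc a * Suc n < (L + 2) * Suc n" using assms by (intro mult_strict_right_mono) auto
  then show ?thesis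
    unfolding spline_deriv_def spline_piece_def using assms u
    by (intro sum.cong refl arg_cong2[of _ _ _ _ "(*\<^sub>R)"] bspline_eq_piece[OF mono_u]) auto
qed

text \<open>The right end point is what matters: the degree \<open>2 * n + 1 - l\<close> is at least
  the multiplicity \<open>n + 1\<close>, so the neighbouring pieces agree there.\<close>

lemma spline_deriv_eq_piece:
  assumes "Suc a \<le> L" "l \<le> n" "t a \<le> x" "x \<le> t (Suc a)"
  shows "spline_deriv l x = spline_piece a l x"
proof (cases "x < t (Suc a)")
  case True
  then show ?thesis using assms by (intro spline_deriv_eq_piece_less) auto
next
  case False
  then have x: "x = t (Suc a)" using assms by simp
  interpret knot_block u "a * Suc n + 1" "Suc n" "t a" "t (Suc a)" "t (Suc (Suc a))"
    using knot_block[of "Suc a"] assms by simp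
  have d: "2 * n + 1 - l = Suc n + (n - l)" using assms by simp
  have j: "a * Suc n + 1 + Suc n - 1 = Suc a * Suc n"
    "a * Suc n + 1 + 2 * Suc n - 1 = Suc (Suc a) * Suc n" by auto
  have "spline_deriv l x = spline_piece (Suc a) l x"
    using assms t_less[of "Suc a"] by (intro spline_deriv_eq_piece_less) (auto simp: x)
  also have "\<dots> = spline_piece a l x"
    unfolding spline_piece_def x d piece_left_eq_right[unfolded j] ..
  finally show ?thesis .
qed

lemma spline_deriv_knot:
  assumes "1 \<le> a" "a \<le> L" "l \<le> n"
  shows "spline_deriv l (t a) = (\<Sum>k=0..n - l. Bernstein (n - l) k ((t a - t (a - 1)) / (t (a + 1) - t (a - 1)))
           *\<^sub>R diff_coeff u (2 * n + 1) c l ((a - 1) * Suc n + 1 + l + k))"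
proof -
  interpret knot_block u "(a - 1) * Suc n + 1" "Suc n" "t (a - 1)" "t a" "t (a + 1)"
    by (rule knot_block[OF assms(1,2)])
  define h where "h = (a - 1) * Suc n + 1"
  define x where "x = (t a - t (a - 1)) / (t (a + 1) - t (a - 1))"
  have d: "2 * n + 1 - l = Suc n + (n - l)" using assms by simp
  obtain a' where a': "a = Suc a'" using assms by (cases a) auto
  have j: "h + 2 * Suc n - 1 = Suc a * Suc n" by (simp add: h_def a')
  let ?N = "L * Suc n + 1"
  have hN: "h + n \<le> ?N"
    using mult_right_mono[OF assms(2), of "Suc n"] by (simp add: h_def a')
  have piece: "bspline_piece u (Suc a * Suc n) (Suc n + (n - l)) i (t a) =
     (if i < h + l then 0 else Bernstein (n - l) (i - (h + l)) x)" for i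
    using piece_right_Bernstein[of "n - l" i] assms(3)
    unfolding h_def[symmetric] j x_def[symmetric] by (auto intro!: arg_cong[of _ _ "\<lambda>k. Bernstein _ k x"])
  have "spline_deriv l (t a) = spline_piece a l (t a)"
    using assms t_less[of a] by (intro spline_deriv_eq_piece_less) auto
  also have "\<dots> = (\<Sum>i\<in>{l..?N}. (if i < h + l then 0 else Bernstein (n - l) (i - (h + l)) x)
     *\<^sub>R diff_coeff u (2 * n + 1) c l i)"
    unfolding spline_piece_def d piece ..
  \<comment> \<open>Below \<open>h + l\<close> the guard gives 0, above \<open>h + n\<close> the
    Bernstein index exceeds the degree.\<close>
  also have "\<dots> = (\<Sum>i\<in>{h + l..h + n}. Bernstein (n - l) (i - (h + l)) x *\<^sub>R diff_coeff u (2 * n + 1) c l i)"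
    using hN assms(3) by (intro sum.mono_neutral_cong_right) (auto simp: Bernstein_def binomial_eq_0)
  also have "\<dots> = (\<Sum>k\<in>{0..n - l}. Bernstein (n - l) k x *\<^sub>R diff_coeff u (2 * n + 1) c l (h + l + k))"
    using assms(3)
    by (intro sum.reindex_bij_witness[of _ "\<lambda>k. h + l + k" "\<lambda>i. i - (h + l)"]) auto
  finally show ?thesis by (simp add: h_def x_def)
qed

lemma spline_piece_derivative:
  assumes "1 \<le> a" "Suc a \<le> L" "l \<le> n"
  shows "(spline_piece a l has_vector_derivative spline_piece a (Suc l) x) (at x)"
proof -
  define d where "d = 2 * n + 1 - l"
  define N where "N = L * Suc n + 1"
  define j where "j = Suc a * Suc n"
  define C where "C = diff_coeff u (2 * n + 1) c l"
  define G where "G = (\<lambda>i. real d * (bspline_piece u j (d - 1) i x / (u (i + d) - u i)))"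
  have jl: "2 * Suc n \<le> j" unfolding j_def using assms by (intro mult_right_mono) auto
  have jN: "j < N" unfolding j_def N_def using mult_right_mono[OF assms(2), of "Suc n"] by linarith
  have lN: "l \<le> N" using jl jN assms by simp
  have D: "(bspline_piece u j d i has_real_derivative G i - G (Suc i)) (at x)" if "i \<le> N" for i
  proof -
    have "i + d < (L + 2) * Suc n + 1" using that by (simp add: N_def d_def)
    from has_field_derivative_bspline_piece[OF mono_u this, of j x] show ?thesis
      by (simp add: G_def algebra_simps)
  qed
  have "(spline_piece a l has_vector_derivative (\<Sum>i=l..N. (G i - G (Suc i)) *\<^sub>R C i)) (at x)"
    unfolding spline_piece_def[abs_def] d_def[symmetric] N_def[symmetric] j_def[symmetric] C_def[symmetric]
    by (intro has_vector_derivative_sum)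
      (auto intro!: derivative_eq_intros D)
  also have "(\<Sum>i=l..N. (G i - G (Suc i)) *\<^sub>R C i)
      = (\<Sum>i=Suc l..N. G i *\<^sub>R (C i - C (i - 1))) + G l *\<^sub>R C l - G (Suc N) *\<^sub>R C N"
    by (rule sum_by_parts_nat[OF lN])
  \<comment> \<open>The boundary terms vanish by local support:
    \<open>l + (d - 1) = 2 * n < j\<close> on the left and \<open>j < Suc N\<close> on the
    right.\<close>
  also have "G l = 0" using jl assms by (simp add: G_def d_def bspline_piece_eq_0)
  also have "G (Suc N) = 0" using jN by (simp add: G_def bspline_piece_eq_0)
  also have "(\<Sum>i=Suc l..N. G i *\<^sub>R (C i - C (i - 1))) + 0 *\<^sub>R C l - 0 *\<^sub>R C N
      = (\<Sum>i=Suc l..N. G i *\<^sub>R (C i - C (i - 1)))" by simp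
  also have "\<dots> = spline_piece a (Suc l) x"
    unfolding spline_piece_def N_def[symmetric]
    by (intro sum.cong refl) (simp add: C_def G_def j_def d_def ac_simps)
  finally show ?thesis .
qed

text \<open>On each closed knot interval both functions are polynomial pieces. The one-sided
  derivatives glue because \<open>Suc l \<le> n\<close> makes \<open>spline_deriv (Suc l)\<close>
  the correct value from both sides of a knot.\<close>

lemma spline_deriv_derivative:
  assumes "1 \<le> a" "Suc l \<le> n" "a + k < L" "x \<in> {t a..t (a + Suc k)}"
  shows "(spline_deriv l has_vector_derivative spline_deriv (Suc l) x) (at x within {t a..t (a + Suc k)})"
  using assms(3,4)
proof (induction k arbitrary: x)
  have step: "(spline_deriv l has_vector_derivative spline_deriv (Suc l) x) (at x within {t b..t (Suc b)})"
    if "1 \<le> b" "Suc b \<le> L" "x \<in> {t b..t (Suc b)}" for b x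
  proof -
    have "(spline_piece b l has_vector_derivative spline_deriv (Suc l) x) (at x within {t b..t (Suc b)})"
      using that assms spline_piece_derivative[of b l x] spline_deriv_eq_piece[of b "Suc l" x]
      by (auto intro: has_vector_derivative_at_within)
    then show ?thesis
      by (rule has_vector_derivative_transform[rotated 2]) (use that assms in \<open>auto intro!: spline_deriv_eq_piece\<close>)
  qed
  {
    case 0
    then show ?case using step[of a] assms by auto
  next
    case (Suc k)
    have "t a \<le> t (a + Suc k)"
      using Suc.prems by (intro t_mono) auto
    moreover have "t (a + Suc k) \<le> t (a + Suc (Suc k))"
      using t_less[of "a + Suc k"] Suc.prems by auto
    ultimately have un: "{t a..t (a + Suc (Suc k))} = {t a..t (a + Suc k)} \<union> {t (a + Suc k)..t (a + Suc (Suc k))}"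
      by auto
    show ?case
      using Suc.prems assms Suc.IH step[of "a + Suc k"] unfolding un
      by (intro has_vector_derivative_within_Un) auto
  }
qed

text \<open>Serves the top order \<open>l = n\<close>, which \<open>spline_deriv_derivative\<close>
  does not differentiate.\<close>

lemma spline_deriv_continuous:
  assumes "1 \<le> a" "l \<le> n" "a + k < L"
  shows "continuous_on {t a..t (a + Suc k)} (spline_deriv l)"
  using assms(3)
proof (induction k)
  have step: "continuous_on {t b..t (Suc b)} (spline_deriv l)" if "1 \<le> b" "Suc b \<le> L" for b
  proof -
    have "continuous_on {t b..t (Suc b)} (spline_piece b l)"
      using spline_piece_derivative[OF that assms(2)]
      by (intro continuous_at_imp_continuous_on ballI has_vector_derivative_continuous)
    then show ?thesis
      by (rule continuous_on_cong[THEN iffD1, rotated 2])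
        (use that assms in \<open>auto simp: spline_deriv_eq_piece\<close>)
  qed
  {
    case 0
    then show ?case using step[of a] assms by auto
  next
    case (Suc k)
    have "t a \<le> t (a + Suc k)" "t (a + Suc k) \<le> t (a + Suc (Suc k))"
      using Suc.prems by (intro t_mono; simp)+
    then have "{t a..t (a + Suc (Suc k))} = {t a..t (a + Suc k)} \<union> {t (a + Suc k)..t (a + Suc (Suc k))}"
      by auto
    then show ?case
      using Suc step[of "a + Suc k"] assms by (auto intro!: continuous_on_closed_Un)
  }
qed

text \<open>For the \<open>n + 1\<close> control points relevant at \<open>t a\<close>, each
  difference has its left knot in block \<open>a - 1\<close> and its right knot in block
  \<open>a + 1\<close>, so all share one denominator.\<close>

lemma diff_coeff_knot:
  assumes "1 \<le> a" "a \<le> L" "l < n" "k \<le> n - Suc l"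
  defines "h \<equiv> (a - 1) * Suc n + 1"
  shows "diff_coeff u (2 * n + 1) c (Suc l) (h + Suc l + k) =
     (real (2 * n + 1 - l) / (t (a + 1) - t (a - 1))) *\<^sub>R
       (diff_coeff u (2 * n + 1) c l (h + l + Suc k) - diff_coeff u (2 * n + 1) c l (h + l + k))"
proof -
  interpret knot_block u h "Suc n" "t (a - 1)" "t a" "t (a + 1)"
    unfolding h_def by (rule knot_block[OF assms(1,2)])
  have "u (h + Suc l + k) = t (a - 1)"
    using assms by (intro ua) auto
  moreover have "u (h + Suc l + k + (2 * n + 1 - l)) = t (a + 1)"
    using assms(3,4) by (intro ub) auto
  ultimately show ?thesis by simp
qed

end

section \<open>Agreement of all derivatives at the two ends\<close>

lemma Bernstein_differences_eq_0_iff: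
  fixes E :: "nat \<Rightarrow> nat \<Rightarrow> 'a::real_vector"
  assumes E: "\<And>l k. l < n \<Longrightarrow> k \<le> n - Suc l \<Longrightarrow> E (Suc l) k = \<kappa> l *\<^sub>R (E l (Suc k) - E l k)"
    and \<kappa>: "\<And>l. l < n \<Longrightarrow> \<kappa> l \<noteq> 0"
  shows "(\<forall>l\<le>n. (\<Sum>k=0..n - l. Bernstein (n - l) k x *\<^sub>R E l k) = 0) \<longleftrightarrow> (\<forall>k\<le>n. E 0 k = 0)"
proof
  assume 0: "\<forall>k\<le>n. E 0 k = 0"
  have "l \<le> n \<Longrightarrow> k \<le> n - l \<Longrightarrow> E l k = 0" for l k
  proof (induction l arbitrary: k)
    case (Suc l)
    then have "E l (Suc k) = 0" "E l k = 0" by auto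
    then show ?case using E[of l k] Suc.prems by simp
  qed (use 0 in auto)
  then show "\<forall>l\<le>n. (\<Sum>k=0..n - l. Bernstein (n - l) k x *\<^sub>R E l k) = 0" by simp
next
  assume sum0: "\<forall>l\<le>n. (\<Sum>k=0..n - l. Bernstein (n - l) k x *\<^sub>R E l k) = 0"
  have "\<forall>k\<le>n - l. E l k = 0" if "l \<le> n" for l
    using that
  \<comment> \<open>Downward from \<open>l = n\<close>, where the sum is the single term
    \<open>E n 0\<close>.\<close>
  proof (induction l rule: inc_induct)
    case base
    then show ?case using sum0[rule_format, of n] by (simp add: Bernstein_def)
  next
    case (step l)
    have "E l (Suc k) = E l k" if "Suc k \<le> n - l" for k
    proof -
      from that have k: "k \<le> n - Suc l" by simp
      then have "\<kappa> l *\<^sub>R (E l (Suc k) - E l k) = 0"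
        using E[of l k] step.IH step.hyps by simp
      then show ?thesis using \<kappa>[of l] step.hyps by simp
    qed
    then have const: "k \<le> n - l \<Longrightarrow> E l k = E l 0" for k
      by (induction k) auto
    have "0 = (\<Sum>k=0..n - l. Bernstein (n - l) k x *\<^sub>R E l k)" using sum0 step by simp
    also have "\<dots> = (\<Sum>k=0..n - l. Bernstein (n - l) k x *\<^sub>R E l 0)"
      using const by (intro sum.cong refl arg_cong2[of _ _ _ _ "(*\<^sub>R)"] const) auto
    also have "\<dots> = E l 0"
      unfolding scaleR_sum_left[symmetric] atLeast0AtMost sum_Bernstein by simp
    finally have "E l 0 = 0" by simp
    then show ?case using const by metis
  qed
  from this[of 0] show "\<forall>k\<le>n. E 0 k = 0" by simp
qed

text \<open>Derivatives within a nondegenerate interval are unique, so any witness of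
  \<open>closed_Cn\<close> coincides with the given \<open>D\<close>.\<close>

lemma closed_Cn_iff:
  assumes "a < b" and f: "\<And>x. x \<in> {a..b} \<Longrightarrow> D 0 x = f x"
    and D: "\<And>l x. l < n \<Longrightarrow> x \<in> {a..b} \<Longrightarrow> (D l has_vector_derivative D (Suc l) x) (at x within {a..b})"
    and cont: "continuous_on {a..b} (D n)"
  shows "closed_Cn n f a b \<longleftrightarrow> (\<forall>l\<le>n. D l a = D l b)"
proof
  assume "closed_Cn n f a b"
  then obtain D' where f': "\<And>x. x \<in> {a..b} \<Longrightarrow> D' 0 x = f x"
    and D': "\<And>l x. l < n \<Longrightarrow> x \<in> {a..b} \<Longrightarrow> (D' l has_vector_derivative D' (Suc l) x) (at x within {a..b})"
    and ends: "\<And>l. l \<le> n \<Longrightarrow> D' l a = D' l b"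
    unfolding closed_Cn_def by blast
  have "l \<le> n \<Longrightarrow> x \<in> {a..b} \<Longrightarrow> D l x = D' l x" for l x
  proof (induction l arbitrary: x)
    case 0
    then show ?case using f f' by simp
  next
    case (Suc l)
    then have "(D l has_vector_derivative D' (Suc l) x) (at x within {a..b})"
      by (intro has_vector_derivative_transform[OF _ _ D'[of l x]]) auto
    then show ?case
      using vector_derivative_unique_within_closed_interval
        [OF \<open>a < b\<close>, of x "D l" "D (Suc l) x" "D' (Suc l) x"] D[of l x] Suc.prems by simp
  qed
  with ends \<open>a < b\<close> show "\<forall>l\<le>n. D l a = D l b" by simp
next
  assume "\<forall>l\<le>n. D l a = D l b"
  with assms show "closed_Cn n f a b"
    unfolding closed_Cn_def by (intro exI[of _ D]) auto
qed

section \<open>Strictness and indexing of the knots \<open>nu\<close> and \<open>rho\<close>\<close>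

lemma nu_knots_mono:
  assumes "\<And>i. i \<le> p + n \<Longrightarrow> t i \<le> t (i + 1)"
  shows "mono_on {..(p + n + 2) * Suc n - 1} (nu_knots n t)"
proof (rule mono_onI)
  fix i j assume ij: "i \<in> {..(p + n + 2) * Suc n - 1}" "j \<in> {..(p + n + 2) * Suc n - 1}" "i \<le> j"
  then have "j div Suc n < p + n + 2" by (intro less_mult_imp_div_less) simp
  moreover have "i div Suc n \<le> j div Suc n" using ij by (intro div_le_mono)
  moreover have "mono_on {..p + n + 1} t" by (rule knots_mono, rule assms) simp
  ultimately show "nu_knots n t i \<le> nu_knots n t j"
    using mono_onD[of "{..p + n + 1}" t "i div Suc n" "j div Suc n"] by (simp add: nu_knots_def)
qed

text \<open>If two consecutive knots coincide, the B-spline whose support lies between them vanishes,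
  and its Gram row is zero: the linear system is then not uniquely solvable.\<close>

lemma is_the_solution_imp_strict_knots:
  assumes sol: "is_the_solution ((n + 1) * (p + n)) (gram_entry n p t) b x"
    and t: "\<And>i. i \<le> p + n \<Longrightarrow> t i \<le> t (i + 1)" and a: "a \<le> p + n"
  shows "t a < t (a + 1)"
proof (rule ccontr)
  assume "\<not> t a < t (a + 1)"
  then have ta: "t (a + 1) = t a" using t[OF a] by simp
  let ?q = "(n + 1) * (p + n)"
  \<comment> \<open>The first copy of \<open>t a\<close> in \<open>nu\<close>. The B-spline of
    degree \<open>2 * n\<close> starting there has \<open>2 * (n + 1)\<close> knots: exactly the
    copies of \<open>t a\<close> and of \<open>t (a + 1)\<close>.\<close>
  define k where "k = a * Suc n"
  have k: "k \<le> ?q" using mult_right_mono[OF a, of "Suc n"] by (simp add: k_def mult.commute)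
  have "(k + Suc (2 * n)) div Suc n = Suc a"
    by (intro div_nat_eqI) (auto simp: k_def)
  moreover have "k div Suc n = a"
    by (simp only: k_def nonzero_mult_div_cancel_right)
  ultimately have "nu_knots n t (k + Suc (2 * n)) \<le> nu_knots n t k"
    using ta by (simp add: nu_knots_def)
  moreover have "k + 2 * n < (p + n + 2) * Suc n - 1"
    using k by (simp add: algebra_simps)
  ultimately have zero: "bspline (nu_knots n t) (2 * n) k y = 0" for y
    by (intro bspline_eq_0[OF nu_knots_mono[of p n t, OF t]])
  then have g: "gram_entry n p t l k = 0" for l by (simp add: gram_entry_def)
  define y where "y = x(k := x k + 1)"
  have "(\<Sum>l\<le>?q. gram_entry n p t i l * y l) = (\<Sum>l\<le>?q. gram_entry n p t i l * x l)" for i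
    by (intro sum.cong refl) (auto simp: y_def g)
  with sol have "solves ?q (gram_entry n p t) b y"
    unfolding is_the_solution_def solves_def by simp
  with sol k have "y k = x k" unfolding is_the_solution_def by blast
  then show False by (simp add: y_def)
qed

lemma refined_knots_rho:
  assumes strict: "\<And>a. a \<le> p + n \<Longrightarrow> t a < t (a + 1)"
    and "t_left \<le> t 0" "t (p + n + 1) \<le> t_right"
  shows "refined_knots n (p + n) t (rho_knots n p t t_left t_right)"
proof
  show "t a < t (Suc a)" if "a \<le> p + n" for a using strict[OF that] by simp
  let ?K = "(p + n + 2) * Suc n" and ?u = "rho_knots n p t t_left t_right"
  show u: "?u (Suc i) = t (i div Suc n)" if "i < ?K" for i
    using that by (auto simp: rho_knots_def nu_knots_def)
  have last: "(?K - 1) div Suc n = p + n + 1"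
    by (intro div_nat_eqI) auto
  have step: "?u i \<le> ?u (Suc i)" if i: "i < ?K + 1" for i
  proof -
    consider "i = 0" | i' where "i = Suc i'" "Suc i' < ?K" | "i = ?K"
    proof (cases "i = 0 \<or> i = ?K")
      case False
      then obtain i' where "i = Suc i'" by (cases i) auto
      moreover have "i < ?K" using i False by linarith
      ultimately show ?thesis using that by blast
    qed (use that in blast)
    then show ?thesis
    proof cases
      case 1
      then show ?thesis using assms(2) u[of 0] by (simp add: rho_knots_def)
    next
      case 2
      have "nu_knots n t i' \<le> nu_knots n t (Suc i')"
        using 2 by (intro mono_onD[OF nu_knots_mono]) (use less_imp_le[OF strict] in auto)
      then show ?thesis using 2 u[of i'] u[of "Suc i'"] by (simp add: nu_knots_def)
    next
      case 3
      then have "?u i = t (p + n + 1)" using u[of "?K - 1"] last by simp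
      moreover have "?u (Suc i) = t_right" using 3 by (simp add: rho_knots_def)
      ultimately show ?thesis using assms(3) by simp
    qed
  qed
  then show "mono_on {..?K + 1} ?u"
    by (intro knots_mono) simp
qed

text \<open>The recursion for \<open>rc\<close> inverts the difference quotient, provided that the
  knot difference is nonzero. It is: indices \<open>2 * n + 1 \<ge> n + 1\<close> apart lie in
  different blocks. The shift \<open>i + 1\<close> comes from the front knot of
  \<open>rho\<close>.\<close>

lemma diff_coeff_rho_knots:
  assumes strict: "\<And>a. a \<le> p + n \<Longrightarrow> t a < t (a + 1)"
    and rc: "rc (i + 1) = rc i + ((nu_knots n t (i + 2 * n + 1) - nu_knots n t i) / real (2 * n + 1)) *\<^sub>R pc i"
    and i: "i \<le> (n + 1) * (p + n)"
  shows "diff_coeff (rho_knots n p t t_left t_right) (2 * n + 1) rc 1 (i + 1) = pc i"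
proof -
  have last: "i + 2 * n + 1 < (p + n + 2) * (n + 1)" using i by (simp add: algebra_simps)
  define a where "a = i div (n + 1)"
  define b where "b = (i + 2 * n + 1) div (n + 1)"
  have "a \<le> (n + 1) * (p + n) div (n + 1)" unfolding a_def by (rule div_le_mono[OF i])
  also have "\<dots> = p + n" by (rule nonzero_mult_div_cancel_left) simp
  finally have less: "t a < t (a + 1)" by (rule strict)
  have "a + 1 = (i + (n + 1)) div (n + 1)"
    unfolding a_def by (rule div_add_self2[symmetric]) simp
  then have "a + 1 \<le> b" unfolding b_def by (simp only:) (intro div_le_mono, simp)
  moreover have "b < p + n + 2"
    unfolding b_def by (rule less_mult_imp_div_less[OF last])
  moreover have "mono_on {..p + n + 1} t"
    by (rule knots_mono, rule less_imp_le, rule strict) simp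
  ultimately have "t (a + 1) \<le> t b"
    using mono_onD[of "{..p + n + 1}" t "a + 1" b] by simp
  with less have "t a < t b" by simp
  then have "nu_knots n t i < nu_knots n t (i + 2 * n + 1)"
    by (simp only: nu_knots_def a_def b_def)
  then have "real (2 * n + 1) / (nu_knots n t (i + 2 * n + 1) - nu_knots n t i)
      * ((nu_knots n t (i + 2 * n + 1) - nu_knots n t i) / real (2 * n + 1)) = 1"
    by simp
  moreover have "rho_knots n p t t_left t_right (i + 1) = nu_knots n t i"
    "rho_knots n p t t_left t_right (i + 1 + (2 * n + 1)) = nu_knots n t (i + 2 * n + 1)"
    using last by (simp_all add: rho_knots_def del: mult_Suc mult_Suc_right)
  ultimately show ?thesis
    unfolding One_nat_def diff_coeff.simps
    unfolding One_nat_def[symmetric] diff_zero add_diff_cancel_right' rc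
    by (simp only: add_diff_cancel_left' scaleR_scaleR scaleR_one)
qed

section \<open>Assembly of the clamped case (a) and the closed case (b)\<close>

theorem proposition1:
  fixes n p m q :: nat
    and t s s' :: "nat \<Rightarrow> real"
    and t_left t_right \<alpha> \<beta> :: real
    and z pc rc :: "nat \<Rightarrow> complex"
    and chi :: "nat \<Rightarrow> nat \<Rightarrow> nat \<Rightarrow> real"
    and r :: "real \<Rightarrow> complex"
  assumes "n \<ge> 1" and "p \<ge> n" and "q = (n + 1) * (p + n)"
    and "\<And>i. i \<le> p + n \<Longrightarrow> t i \<le> t (i + 1)"
    and "t_left \<le> t 0" and "t (p + n + 1) \<le> t_right"
    and "s = nu_knots n t"
    and "s' = rho_knots n p t t_left t_right"
    and "\<And>i j. i \<le> p \<Longrightarrow> j \<le> p \<Longrightarrow>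
           is_the_solution q (gram_entry n p t) (rhs_entry n p t i j) (chi i j)"
    and "\<And>k. k \<le> q \<Longrightarrow> pc k = (\<Sum>i\<le>p. \<Sum>j\<le>p. of_real (chi i j k) * z i * z j)"
    and "\<And>i. i \<le> q \<Longrightarrow>
           rc (i + 1) = rc i + ((s (i + 2 * n + 1) - s i) / real (2 * n + 1)) *\<^sub>R pc i"
    and "r = spline_curve s' (2 * n + 1) (q + 1) rc"
    and "\<alpha> = (t n - t (n - 1)) / (t (n + 1) - t (n - 1))"
    and "\<beta> = (t (m + 1) - t m) / (t (m + 2) - t m)"
  shows "(p = m \<longrightarrow>
            (r (t n) = rc 0 \<and>
             r (t (m + 1)) = rc (q + 1) \<and>
             (r has_vector_derivative
                (real (2 * n + 1) / (s' (2 * n + 2) - s' 1)) *\<^sub>R (rc 1 - rc 0))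
                (at (t n) within {t n..t (m + 1)}) \<and>
             (r has_vector_derivative
                (real (2 * n + 1) / (s' (q + 2 * n + 2) - s' (q + 1))) *\<^sub>R (rc (q + 1) - rc q))
                (at (t (m + 1)) within {t n..t (m + 1)})
             \<longleftrightarrow>
             (\<Sum>k=0..n. Bernstein n k \<alpha> *\<^sub>R rc ((n - 1) * (n + 1) + k + 1)) = rc 0 \<and>
             (\<Sum>k=0..n - 1. Bernstein (n - 1) k \<alpha> *\<^sub>R pc ((n - 1) * (n + 1) + k + 1)) = pc 0 \<and>
             (\<Sum>k=0..n. Bernstein n k \<beta> *\<^sub>R rc (m * (n + 1) + k + 1)) = rc (q + 1) \<and>
             (\<Sum>k=0..n - 1. Bernstein (n - 1) k \<beta> *\<^sub>R pc (m * (n + 1) + k + 1)) = pc q))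
         \<and>
         (p = m + n \<longrightarrow>
            (\<forall>k\<in>{n, n + 1}. t (m + 1 + k) - t (m + k) = t k - t (k - 1)) \<longrightarrow>
            (closed_Cn n r (t n) (t (m + n + 1))
             \<longleftrightarrow>
             (\<forall>k\<le>n. (\<Sum>j = n * (n + 1) - k..(m + n + 1) * (n + 1) - k - 1.
                        (s (j + 2 * n + 1) - s j) *\<^sub>R pc j) = 0)))"
proof -
  \<comment> \<open>One system suffices, as the Gram matrix is the same for all \<open>i\<close> and
    \<open>j\<close>.\<close>
  have strict: "t a < t (a + 1)" if "a \<le> p + n" for a
    using assms(9)[of 0 0, unfolded assms(3)] assms(4) that
    by (intro is_the_solution_imp_strict_knots[where b = "rhs_entry n p t 0 0" and x = "chi 0 0"]) auto
  interpret refined_knots n "p + n" t s' rc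
    unfolding assms(8) by (rule refined_knots_rho[OF strict assms(5,6)])
  define dc where "dc = diff_coeff s' (2 * n + 1) rc"
  have r: "r = spline_deriv 0"
    by (auto simp: assms(3,12) spline_curve_def spline_deriv_def atLeast0AtMost mult.commute)
  have pc: "dc 1 (i + 1) = pc i" if "i \<le> q" for i
    unfolding dc_def assms(8) using that assms(3,7,11) by (intro diff_coeff_rho_knots strict) auto
  obtain n' where n': "n = Suc n'" using assms(1) by (cases n) auto
  show ?thesis
  proof (intro conjI impI)
    assume pm: "p = m"
    have mn: "n + Suc (m - n) = m + 1" using assms(2) pm by simp
    have lt: "t n < t (m + 1)"
      using t_less[of n] t_mono[of "Suc n" "m + 1"] assms(2) pm by simp
    have der: "(r has_vector_derivative spline_deriv 1 x) (at x within {t n..t (m + 1)})"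
      if "x \<in> {t n..t (m + 1)}" for x
      using spline_deriv_derivative[of n 0 "m - n" x] that assms(1,2) pm unfolding r mn by simp
    \<comment> \<open>Uniqueness of the one-sided derivative turns the end conditions on the
      derivative into equations between values.\<close>
    have der_iff: "(r has_vector_derivative v) (at x within {t n..t (m + 1)}) \<longleftrightarrow> spline_deriv 1 x = v"
      if "x \<in> {t n..t (m + 1)}" for x v
      using der[OF that] vector_derivative_unique_within_closed_interval[OF lt, of x r "spline_deriv 1 x" v] that by auto
    have ends: "t n \<in> {t n..t (m + 1)}" "t (m + 1) \<in> {t n..t (m + 1)}" using lt by auto
    have "m + 1 \<le> p + n" using assms(1) pm by simp
    note knots = spline_deriv_knot[of n 0] spline_deriv_knot[of n 1] spline_deriv_knot[of "m + 1" 0, OF _ this] spline_deriv_knot[of "m + 1" 1, OF _ this]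
    have r0: "r (t n) = (\<Sum>k=0..n. Bernstein n k \<alpha> *\<^sub>R rc ((n - 1) * (n + 1) + k + 1))"
      using knots(1) assms(1) by (simp add: r assms(13))
    have r1: "r (t (m + 1)) = (\<Sum>k=0..n. Bernstein n k \<beta> *\<^sub>R rc (m * (n + 1) + k + 1))"
      using knots(3) by (simp add: r assms(14))
    have le: "(n - 1) * (n + 1) + k + 1 \<le> q" "m * (n + 1) + k + 1 \<le> q" if "k \<le> n - 1" for k
      using that by (simp_all add: n' assms(3) pm algebra_simps)
    have p0: "spline_deriv 1 (t n) = (\<Sum>k=0..n - 1. Bernstein (n - 1) k \<alpha> *\<^sub>R pc ((n - 1) * (n + 1) + k + 1))"
    proof -
      have "dc 1 ((n - 1) * Suc n + 1 + 1 + k) = pc ((n - 1) * (n + 1) + k + 1)" if "k \<le> n - 1" for k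
        using pc[OF le(1)[OF that]] by (simp only: Suc_eq_plus1 ac_simps)
      then show ?thesis
        using knots(2) assms(1) unfolding dc_def[symmetric] assms(13) by simp
    qed
    have p1: "spline_deriv 1 (t (m + 1)) = (\<Sum>k=0..n - 1. Bernstein (n - 1) k \<beta> *\<^sub>R pc (m * (n + 1) + k + 1))"
    proof -
      have "dc 1 (m * Suc n + 1 + 1 + k) = pc (m * (n + 1) + k + 1)" if "k \<le> n - 1" for k
        using pc[OF le(2)[OF that]] by (simp only: Suc_eq_plus1 ac_simps)
      then show ?thesis
        using knots(4) assms(1) unfolding dc_def[symmetric] assms(14) by simp
    qed
    \<comment> \<open>The prescribed end derivatives are the first and the last control point of the
      hodograph.\<close>
    have "(real (2 * n + 1) / (s' (2 * n + 2) - s' 1)) *\<^sub>R (rc 1 - rc 0) = pc 0"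
      using pc[of 0] by (simp add: dc_def)
    moreover have "(real (2 * n + 1) / (s' (q + 2 * n + 2) - s' (q + 1))) *\<^sub>R (rc (q + 1) - rc q) = pc q"
      using pc[of q] by (simp add: dc_def)
    ultimately show "r (t n) = rc 0 \<and>
             r (t (m + 1)) = rc (q + 1) \<and>
             (r has_vector_derivative
                (real (2 * n + 1) / (s' (2 * n + 2) - s' 1)) *\<^sub>R (rc 1 - rc 0))
                (at (t n) within {t n..t (m + 1)}) \<and>
             (r has_vector_derivative
                (real (2 * n + 1) / (s' (q + 2 * n + 2) - s' (q + 1))) *\<^sub>R (rc (q + 1) - rc q))
                (at (t (m + 1)) within {t n..t (m + 1)})
             \<longleftrightarrow>
             (\<Sum>k=0..n. Bernstein n k \<alpha> *\<^sub>R rc ((n - 1) * (n + 1) + k + 1)) = rc 0 \<and>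
             (\<Sum>k=0..n - 1. Bernstein (n - 1) k \<alpha> *\<^sub>R pc ((n - 1) * (n + 1) + k + 1)) = pc 0 \<and>
             (\<Sum>k=0..n. Bernstein n k \<beta> *\<^sub>R rc (m * (n + 1) + k + 1)) = rc (q + 1) \<and>
             (\<Sum>k=0..n - 1. Bernstein (n - 1) k \<beta> *\<^sub>R pc (m * (n + 1) + k + 1)) = pc q"
      unfolding der_iff[OF ends(1)] der_iff[OF ends(2)] r0 r1 p0 p1 by auto
  next
    assume pm: "p = m + n"
      and spacing: "\<forall>k\<in>{n, n + 1}. t (m + 1 + k) - t (m + k) = t k - t (k - 1)"
    \<comment> \<open>\<open>h1\<close> and \<open>h2\<close> are the first of the
      \<open>n + 1\<close> control point indices relevant at \<open>t n\<close> and at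
      \<open>t (m + n + 1)\<close>.\<close>
    define h1 where "h1 = (n - 1) * Suc n + 1"
    define h2 where "h2 = (m + n) * Suc n + 1"
    define x where "x = (t n - t (n - 1)) / (t (n + 1) - t (n - 1))"
    define w where "w = t (n + 1) - t (n - 1)"
    define E where "E = (\<lambda>l k. dc l (h1 + l + k) - dc l (h2 + l + k))"
    \<comment> \<open>The two spacing conditions give both ends the same Bernstein parameter
      \<open>x\<close> and the same denominator \<open>w\<close>, so the end conditions can be
      subtracted termwise.\<close>
    have sp1: "t (m + n + 1) - t (m + n) = t n - t (n - 1)" using spacing by simp
    have sp2: "t (m + n + 2) - t (m + n + 1) = t (n + 1) - t n" using spacing by simp
    have w2: "t (m + n + 2) - t (m + n) = w" using sp1 sp2 by (simp add: w_def)
    have "t (n - 1) < t n" "t n < t (n + 1)"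
      using t_less[of "n - 1"] t_less[of n] assms(1) by simp_all
    then have w: "0 < w" by (simp add: w_def)
    have lt: "t n < t (m + n + 1)"
      using t_less[of n] t_mono[of "Suc n" "m + n + 1"] pm by simp
    have mn: "n + Suc m = m + n + 1" by simp
    have knot1: "spline_deriv l (t n) = (\<Sum>k=0..n - l. Bernstein (n - l) k x *\<^sub>R dc l (h1 + l + k))" if "l \<le> n" for l
      using spline_deriv_knot[of n l] that assms(1) by (simp add: x_def h1_def dc_def)
    have knot2: "spline_deriv l (t (m + n + 1)) = (\<Sum>k=0..n - l. Bernstein (n - l) k x *\<^sub>R dc l (h2 + l + k))" if "l \<le> n" for l
      using spline_deriv_knot[of "m + n + 1" l] that assms(1) pm w2 sp1
      by (simp add: x_def h2_def dc_def w_def)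
    have "closed_Cn n r (t n) (t (m + n + 1)) \<longleftrightarrow> (\<forall>l\<le>n. spline_deriv l (t n) = spline_deriv l (t (m + n + 1)))"
      using spline_deriv_derivative[of n _ m] spline_deriv_continuous[of n n m] assms(1) pm unfolding mn
      by (intro closed_Cn_iff lt) (auto simp: r)
    also have "\<dots> \<longleftrightarrow> (\<forall>l\<le>n. (\<Sum>k=0..n - l. Bernstein (n - l) k x *\<^sub>R E l k) = 0)"
    proof (intro all_cong)
      fix l assume "l \<le> n"
      then show "spline_deriv l (t n) = spline_deriv l (t (m + n + 1)) \<longleftrightarrow> (\<Sum>k=0..n - l. Bernstein (n - l) k x *\<^sub>R E l k) = 0"
        unfolding knot1[OF \<open>l \<le> n\<close>] knot2[OF \<open>l \<le> n\<close>] E_def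
        by (simp add: scaleR_diff_right sum_subtractf)
    qed
    also have "\<dots> \<longleftrightarrow> (\<forall>k\<le>n. E 0 k = 0)"
    proof (rule Bernstein_differences_eq_0_iff[where \<kappa> = "\<lambda>l. real (2 * n + 1 - l) / w"])
      fix l k assume lk: "l < n" "k \<le> n - Suc l"
      have d1: "dc (Suc l) (h1 + Suc l + k) = (real (2 * n + 1 - l) / w) *\<^sub>R (dc l (h1 + l + Suc k) - dc l (h1 + l + k))"
        using diff_coeff_knot[of n l k] assms(1) lk
        by (simp add: dc_def h1_def w_def del: diff_coeff.simps)
      have d2: "dc (Suc l) (h2 + Suc l + k) = (real (2 * n + 1 - l) / w) *\<^sub>R (dc l (h2 + l + Suc k) - dc l (h2 + l + k))"
        using diff_coeff_knot[of "m + n + 1" l k] assms(1) pm lk w2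
        by (simp add: dc_def h2_def del: diff_coeff.simps)
      show "E (Suc l) k = (real (2 * n + 1 - l) / w) *\<^sub>R (E l (Suc k) - E l k)"
        unfolding E_def d1 d2 by (simp add: algebra_simps)
    qed (use w in auto)
    \<comment> \<open>Reversed, since the limits of the stated sums decrease with
      \<open>k\<close>.\<close>
    also have "\<dots> \<longleftrightarrow> (\<forall>k\<le>n. rc (h1 + (n - k)) = rc (h2 + (n - k)))"
    proof -
      have "(\<forall>k\<le>n. P k) \<longleftrightarrow> (\<forall>k\<le>n. P (n - k))" for P :: "nat \<Rightarrow> bool"
        by (metis diff_diff_cancel diff_le_self)
      from this[of "\<lambda>k. rc (h1 + k) = rc (h2 + k)"] show ?thesis
        by (simp add: E_def dc_def)
    qed
    also have "\<dots> \<longleftrightarrow> (\<forall>k\<le>n. (\<Sum>j = n * (n + 1) - k..(m + n + 1) * (n + 1) - k - 1.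
                        (s (j + 2 * n + 1) - s j) *\<^sub>R pc j) = 0)"
    proof (intro all_cong imp_cong refl)
      fix k assume k: "k \<le> n"
      have lo: "n * (n + 1) - k = h1 + (n - k)"
        using k by (simp add: h1_def n' algebra_simps)
      have hi: "(m + n + 1) * (n + 1) - k = h2 + (n - k)"
        using k by (simp add: h2_def algebra_simps)
      have le: "h1 + (n - k) \<le> h2 + (n - k)"
        by (simp add: h1_def h2_def n' algebra_simps)
      \<comment> \<open>Keeps every summation index at most \<open>q\<close>, where the recursion
        for \<open>rc\<close> is available.\<close>
      have q: "h2 + (n - k) \<le> q + 1"
        by (simp add: h2_def n' assms(3) pm algebra_simps)
      have "(\<Sum>j = n * (n + 1) - k..(m + n + 1) * (n + 1) - k - 1. (s (j + 2 * n + 1) - s j) *\<^sub>R pc j)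
         = (\<Sum>j\<in>{h1 + (n - k)..<h2 + (n - k)}. (s (j + 2 * n + 1) - s j) *\<^sub>R pc j)"
        unfolding lo hi using h2_def by (intro sum.cong) auto
      also have "\<dots> = (\<Sum>j\<in>{h1 + (n - k)..<h2 + (n - k)}. real (2 * n + 1) *\<^sub>R (rc (Suc j) - rc j))"
      proof (intro sum.cong refl)
        fix j assume "j \<in> {h1 + (n - k)..<h2 + (n - k)}"
        then have "rc (j + 1) = rc j + ((s (j + 2 * n + 1) - s j) / real (2 * n + 1)) *\<^sub>R pc j"
          using q by (intro assms(11)) auto
        then show "(s (j + 2 * n + 1) - s j) *\<^sub>R pc j = real (2 * n + 1) *\<^sub>R (rc (Suc j) - rc j)"
          by simp
      qed
      also have "\<dots> = real (2 * n + 1) *\<^sub>R (rc (h2 + (n - k)) - rc (h1 + (n - k)))"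
        by (simp only: scaleR_sum_right[symmetric] sum_Suc_diff'[OF le])
      finally show "rc (h1 + (n - k)) = rc (h2 + (n - k)) \<longleftrightarrow>
        (\<Sum>j = n * (n + 1) - k..(m + n + 1) * (n + 1) - k - 1. (s (j + 2 * n + 1) - s j) *\<^sub>R pc j) = 0"
        by auto
    qed
    finally show "closed_Cn n r (t n) (t (m + n + 1)) \<longleftrightarrow>
             (\<forall>k\<le>n. (\<Sum>j = n * (n + 1) - k..(m + n + 1) * (n + 1) - k - 1.
                        (s (j + 2 * n + 1) - s j) *\<^sub>R pc j) = 0)" .
  qed
qed

end
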